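(* For every multi-index $\mu=(\mu_1,\mu_2)$ there is a constant $C_\mu$, independent of $T$, such that for $T\gg1$ and for every $\alpha\in\Gamma$ with $\alpha\notin\Gamma_{\mathrm{T}_R(\tilde\gamma)}$, such that $\tilde\gamma$ and $\alpha(\tilde\gamma)$ are not contained in a common plane and $2\le\phi(t,s)\le T$ for all $s,t\in[0,1]$, where $\phi(t,s)=d_{\tilde g}(\tilde\gamma(t),\alpha(\tilde\gamma(s)))$, one has $$\|D^\mu\phi\|_\infty\le e^{C_\mu T},$$ where the norm is taken on the unit square $[0,1]^2$.
   Context: $(M,g)$ is a compact 3-dimensional Riemannian manifold of constant curvature $-1$ with sufficiently large injectivity radius $\mathrm{Inj}\,M$; its universal cover is hyperbolic space $\mathbb{H}^3$, with metric $\tilde g$ and distance $d_{\tilde g}$; $\Gamma$ is the group of deck transformations. $\gamma(t)$, $t\in[0,1]$, is a fixed unit-length geodesic segment of $M$ parameterized by arclength, $\tilde\gamma(t)$, $t\in\mathbb{R}$, is a lift to $\mathbb{H}^3$ of the unit-speed geodesic containing it, and $D\subset\mathbb{H}^3$ is a Dirichlet fundamental domain for $M$ centered at $\tilde\gamma(0)$. Fix $R\approx\mathrm{Inj}\,M$ and put $$\mathrm{T}_R(\tilde\gamma)=\{p\in\mathbb{H}^3:d_{\tilde g}(p,\tilde\gamma)\le R\},\qquad \Gamma_{\mathrm{T}_R(\tilde\gamma)}=\{\alpha\in\Gamma:\alpha(D)\cap\mathrm{T}_R(\tilde\gamma)\neq\emptyset\}.$$ "Plane" means totally geodesic hyperbolic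 plane in $\mathbb{H}^3$. $D^\mu=\partial_t^{\mu_1}\partial_s^{\mu_2}$. *)

theory Defs
  imports "HOL-Analysis.Analysis"
begin

section \<open>Hyperbolic 3-space\<close>

text \<open>
  The hyperboloid model: the upper sheet of \<open>x\<^sub>1\<^sup>2 + x\<^sub>2\<^sup>2 + x\<^sub>3\<^sup>2 - x\<^sub>0\<^sup>2 = -1\<close> in Minkowski
  space, with the Riemannian metric (of curvature \<open>-1\<close>) induced by the Minkowski form.  Its
  distance function is \<open>arcosh (- mink p q)\<close>.
\<close>

type_synonym minkowski = "(real^3) \<times> real"

definition mink :: "minkowski \<Rightarrow> minkowski \<Rightarrow> real" where
  "mink p q = fst p \<bullet> fst q - snd p * snd q"

typedef h3 = "{p :: minkowski. mink p p = -1 \<and> snd p > 0}"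
  by (rule exI[of _ "(0, 1)"]) (simp add: mink_def)

lemma mink_sym: "mink p q = mink q p"
  by (simp add: mink_def inner_commute)

lemma mink_add_left: "mink (p + p') q = mink p q + mink p' q"
  and mink_scale_left: "mink (c *\<^sub>R p) q = c * mink p q"
  by (simp_all add: mink_def algebra_simps inner_simps)

lemma mink_add_right: "mink p (q + q') = mink p q + mink p q'"
  and mink_scale_right: "mink p (c *\<^sub>R q) = c * mink p q"
  by (simp_all add: mink_def algebra_simps inner_simps)

lemma mink_Rep_self: "mink (Rep_h3 p) (Rep_h3 p) = -1"
  and snd_Rep_pos: "snd (Rep_h3 p) > 0"
  using Rep_h3[of p] by auto

lemma snd_Rep_eq: "snd (Rep_h3 p) = sqrt (1 + (norm (fst (Rep_h3 p)))\<^sup>2)"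
proof -
  have "(snd (Rep_h3 p))\<^sup>2 = 1 + (norm (fst (Rep_h3 p)))\<^sup>2"
    using mink_Rep_self[of p] unfolding power2_norm_eq_inner by (simp add: mink_def power2_eq_square)
  then show ?thesis using snd_Rep_pos[of p] by (metis less_imp_le real_sqrt_unique)
qed

lemma mink_orth_bound:
  assumes "mink (Rep_h3 p) v = 0"
  shows "(norm (fst v))\<^sup>2 \<le> (snd (Rep_h3 p))\<^sup>2 * mink v v"
proof -
  define x a where "x = fst (Rep_h3 p)" and "a = snd (Rep_h3 p)"
  have a: "(norm x)\<^sup>2 = a\<^sup>2 - 1"
    using snd_Rep_eq[of p] by (auto simp: x_def a_def)
  have "a * snd v = x \<bullet> fst v" using assms by (simp add: mink_def x_def a_def)
  then have "\<bar>a * snd v\<bar> \<le> norm x * norm (fst v)" using Cauchy_Schwarz_ineq2[of x "fst v"] by simp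
  then have "(a * snd v)\<^sup>2 \<le> (norm x * norm (fst v))\<^sup>2"
    using power_mono[of "\<bar>a * snd v\<bar>" "norm x * norm (fst v)" 2] by simp
  then have "a\<^sup>2 * (snd v)\<^sup>2 \<le> (a\<^sup>2 - 1) * (norm (fst v))\<^sup>2"
    by (simp add: power_mult_distrib a)
  moreover have "mink v v = (norm (fst v))\<^sup>2 - (snd v)\<^sup>2"
    unfolding power2_norm_eq_inner by (simp add: mink_def power2_eq_square)
  ultimately have "(norm (fst v))\<^sup>2 \<le> a\<^sup>2 * mink v v" by (simp add: right_diff_distrib left_diff_distrib)
  then show ?thesis by (simp add: a_def)
qed

lemma mink_orth_nonneg:
  assumes "mink (Rep_h3 p) v = 0"
  shows "mink v v \<ge> 0"
proof -
  have "0 \<le> (snd (Rep_h3 p))\<^sup>2 * mink v v"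
    using mink_orth_bound[OF assms] by (rule order_trans[rotated]) simp
  then show ?thesis using snd_Rep_pos[of p] by (simp add: zero_le_mult_iff)
qed

lemma mink_orth_Cauchy:
  assumes "mink (Rep_h3 p) u = 0" "mink (Rep_h3 p) w = 0"
  shows "(mink u w)\<^sup>2 \<le> mink u u * mink w w"
proof -
  have q: "0 \<le> mink u u * x\<^sup>2 + 2 * mink u w * x * y + mink w w * y\<^sup>2" for x y
    using mink_orth_nonneg[of p "x *\<^sub>R u + y *\<^sub>R w"] assms
    by (simp add: mink_add_left mink_add_right mink_scale_left mink_scale_right mink_sym[of w u]
        power2_eq_square algebra_simps)
  have nn: "mink u u \<ge> 0" "mink w w \<ge> 0" using assms mink_orth_nonneg by auto
  show ?thesis
  proof (cases "mink w w = 0")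
    case True
    have "mink u w = 0"
    proof (rule ccontr)
      assume "mink u w \<noteq> 0"
      then show False
        using q[of 1 "- (mink u u + 1) / (2 * mink u w)"] True nn by simp
    qed
    then show ?thesis using nn by simp
  next
    case False
    have "0 \<le> mink w w * (mink u u * mink w w - (mink u w)\<^sup>2)"
      using q[of "mink w w" "- mink u w"] by (simp add: power2_eq_square algebra_simps)
    then show ?thesis using False nn by (simp add: zero_le_mult_iff)
  qed
qed

lemma mink_Rep_le: "- mink (Rep_h3 p) (Rep_h3 q) \<ge> 1"
proof -
  define c where "c = - mink (Rep_h3 p) (Rep_h3 q)"
  have "mink (Rep_h3 p) (Rep_h3 q - c *\<^sub>R Rep_h3 p) = 0"
    using mink_add_right[of _ "Rep_h3 q" "(- c) *\<^sub>R Rep_h3 p"]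
      mink_scale_right[of _ "- c" "Rep_h3 p"] mink_Rep_self[of p] by (simp add: c_def)
  then have "0 \<le> mink (Rep_h3 q + (- c) *\<^sub>R Rep_h3 p) (Rep_h3 q + (- c) *\<^sub>R Rep_h3 p)"
    using mink_orth_nonneg by simp
  also have "\<dots> = c\<^sup>2 - 1"
    by (simp only: mink_add_left mink_add_right mink_scale_left mink_scale_right mink_Rep_self)
       (simp add: c_def mink_sym[of "Rep_h3 q" "Rep_h3 p"] power2_eq_square)
  finally have c2: "1 \<le> c\<^sup>2" by simp
  have "fst (Rep_h3 p) \<bullet> fst (Rep_h3 q) \<le> norm (fst (Rep_h3 p)) * norm (fst (Rep_h3 q))"
    by (rule norm_cauchy_schwarz)
  also have "\<dots> \<le> snd (Rep_h3 p) * snd (Rep_h3 q)"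
    unfolding snd_Rep_eq by (intro mult_mono real_le_rsqrt) auto
  finally have "c \<ge> 0" by (simp add: c_def mink_def)
  with c2 have "c \<ge> 1" using power2_le_imp_le[of 1 c] by simp
  then show ?thesis by (simp add: c_def)
qed

definition hdist :: "h3 \<Rightarrow> h3 \<Rightarrow> real" where
  "hdist p q = arcosh (- mink (Rep_h3 p) (Rep_h3 q))"

lemma cosh_hdist: "cosh (hdist p q) = - mink (Rep_h3 p) (Rep_h3 q)"
  unfolding hdist_def by (rule cosh_arcosh_real) (rule mink_Rep_le)

lemma hdist_nonneg: "hdist p q \<ge> 0"
  unfolding hdist_def by (rule arcosh_nonneg_real) (rule mink_Rep_le)

lemma hdist_sym: "hdist p q = hdist q p"
  by (simp add: hdist_def mink_sym)

lemma hdist_eq_0: "hdist p q = 0 \<longleftrightarrow> p = q"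
proof
  assume "p = q" then show "hdist p q = 0" by (simp add: hdist_def mink_Rep_self)
next
  assume "hdist p q = 0"
  then have m: "mink (Rep_h3 p) (Rep_h3 q) = -1" using cosh_hdist[of p q] by simp
  define v where "v = Rep_h3 q + (-1) *\<^sub>R Rep_h3 p"
  note bil = mink_add_left mink_add_right mink_scale_left mink_scale_right
  have orth: "mink (Rep_h3 p) v = 0"
    unfolding v_def bil using m mink_Rep_self[of p] by simp
  have null: "mink v v = 0"
    unfolding v_def bil using m mink_sym[of "Rep_h3 q" "Rep_h3 p"] by (simp add: mink_Rep_self)
  have f0: "fst v = 0" using mink_orth_bound[OF orth] null by simp
  then have "snd v = 0" using null by (simp add: mink_def)
  then have "v = 0" using f0 by (simp add: prod_eq_iff)
  then have "Rep_h3 q = Rep_h3 p" by (simp add: v_def)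
  then show "p = q" by (simp add: Rep_h3_inject)
qed

lemma hdist_triangle: "hdist p r \<le> hdist p q + hdist q r"
proof -
  define P Q S where "P = Rep_h3 p" and "Q = Rep_h3 q" and "S = Rep_h3 r"
  define a b where "a = hdist p q" and "b = hdist q r"
  have a: "mink P Q = - cosh a" "a \<ge> 0" and b: "mink Q S = - cosh b" "b \<ge> 0"
    using cosh_hdist[of p q] cosh_hdist[of q r] hdist_nonneg by (auto simp: P_def Q_def S_def a_def b_def)
  have s: "mink P P = -1" "mink Q Q = -1" "mink S S = -1"
    by (auto simp: P_def Q_def S_def mink_Rep_self)
  define u w where "u = P + (- cosh a) *\<^sub>R Q" and "w = S + (- cosh b) *\<^sub>R Q"
  note bil = mink_add_left mink_add_right mink_scale_left mink_scale_right
  have "mink Q u = 0" "mink Q w = 0"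
    unfolding u_def w_def bil using a b s mink_sym[of P Q] by simp_all
  moreover have "mink u u = (sinh a)\<^sup>2"
    unfolding u_def bil using a s mink_sym[of P Q] by (simp add: sinh_square_eq) (simp add: power2_eq_square)
  moreover have "mink w w = (sinh b)\<^sup>2"
    unfolding w_def bil using b s mink_sym[of Q S] by (simp add: sinh_square_eq) (simp add: power2_eq_square)
  ultimately have "(mink u w)\<^sup>2 \<le> (sinh a * sinh b)\<^sup>2"
    using mink_orth_Cauchy[of q u w] by (simp add: Q_def power_mult_distrib)
  then have "- mink u w \<le> sinh a * sinh b"
    using a(2) b(2) abs_le_square_iff[of "mink u w" "sinh a * sinh b"] by simp
  moreover have "mink u w = mink P S + cosh a * cosh b"
    unfolding u_def w_def bil using a b s by simp
  ultimately have "- mink P S \<le> cosh (a + b)" by (simp add: cosh_add)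
  then have "cosh (hdist p r) \<le> cosh (a + b)" by (simp add: cosh_hdist P_def S_def)
  then show ?thesis
    using a(2) b(2) hdist_nonneg[of p r] cosh_real_nonneg_le_iff[of "hdist p r" "a + b"]
    by (simp add: a_def b_def)
qed

instantiation h3 :: metric_space
begin

definition dist_h3 :: "h3 \<Rightarrow> h3 \<Rightarrow> real" where
  "dist_h3 = hdist"

definition uniformity_h3 :: "(h3 \<times> h3) filter" where
  "uniformity_h3 = (INF e\<in>{0 <..}. principal {(x, y). dist x y < e})"

definition open_h3 :: "h3 set \<Rightarrow> bool" where
  "open_h3 U \<longleftrightarrow> (\<forall>x\<in>U. eventually (\<lambda>(x', y). x' = x \<longrightarrow> y \<in> U) uniformity)"

instance
proof
  fix x y z :: h3
  show "dist x y = 0 \<longleftrightarrow> x = y" by (simp add: dist_h3_def hdist_eq_0)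
  show "dist x y \<le> dist x z + dist y z"
    using hdist_triangle[of x y z] by (simp add: dist_h3_def hdist_sym)
qed (rule uniformity_h3_def open_h3_def)+

end

definition geodesic_line :: "(real \<Rightarrow> h3) \<Rightarrow> bool" where
  "geodesic_line c \<longleftrightarrow> (\<forall>s t. dist (c s) (c t) = \<bar>s - t\<bar>)"

text \<open>
  The totally geodesic planes of the hyperboloid model are its nonempty sections by
  3-dimensional linear subspaces (which are then automatically time-like).
\<close>

definition hyperbolic_plane :: "h3 set \<Rightarrow> bool" where
  "hyperbolic_plane P \<longleftrightarrow>
     P \<noteq> {} \<and> (\<exists>V. subspace V \<and> dim V = 3 \<and> P = {p. Rep_h3 p \<in> V})"

definition hyperbolic_isometry :: "(h3 \<Rightarrow> h3) \<Rightarrow> bool" where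
  "hyperbolic_isometry f \<longleftrightarrow> bij f \<and> (\<forall>x y. dist (f x) (f y) = dist x y)"


section \<open>Compact hyperbolic 3-manifolds\<close>

text \<open>
  A compact Riemannian 3-manifold of constant curvature \<open>-1\<close> is given as the orbit space
  \<open>\<Gamma> \ H\<^sup>3\<close> of its group \<open>\<Gamma>\<close> of deck transformations; \<open>orbit \<Gamma>\<close> is the universal covering map.
\<close>

definition orbit :: "(h3 \<Rightarrow> h3) set \<Rightarrow> h3 \<Rightarrow> h3 set" where
  "orbit \<Gamma> p = {\<alpha> p | \<alpha>. \<alpha> \<in> \<Gamma>}"

definition orbit_topology :: "(h3 \<Rightarrow> h3) set \<Rightarrow> h3 set topology" where
  "orbit_topology \<Gamma> = topology (\<lambda>U. U \<subseteq> range (orbit \<Gamma>) \<and> open (orbit \<Gamma> -` U))"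

lemma openin_orbit_topology:
  "openin (orbit_topology \<Gamma>) U \<longleftrightarrow> U \<subseteq> range (orbit \<Gamma>) \<and> open (orbit \<Gamma> -` U)"
proof -
  have "istopology (\<lambda>U. U \<subseteq> range (orbit \<Gamma>) \<and> open (orbit \<Gamma> -` U))"
    unfolding istopology_def by (auto simp: vimage_Int vimage_Union)
  then show ?thesis unfolding orbit_topology_def by (simp add: topology_inverse')
qed

definition isometry_group :: "(h3 \<Rightarrow> h3) set \<Rightarrow> bool" where
  "isometry_group \<Gamma> \<longleftrightarrow>
     (\<forall>\<alpha>\<in>\<Gamma>. hyperbolic_isometry \<alpha>) \<and> id \<in> \<Gamma> \<and>
     (\<forall>\<alpha>\<in>\<Gamma>. \<forall>\<beta>\<in>\<Gamma>. \<alpha> \<circ> \<beta> \<in> \<Gamma>) \<and> (\<forall>\<alpha>\<in>\<Gamma>. inv \<alpha> \<in> \<Gamma>)"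

definition compact_hyperbolic_manifold :: "(h3 \<Rightarrow> h3) set \<Rightarrow> bool" where
  "compact_hyperbolic_manifold \<Gamma> \<longleftrightarrow>
     isometry_group \<Gamma> \<and>
     (\<forall>\<alpha>\<in>\<Gamma>. \<alpha> \<noteq> id \<longrightarrow> (\<forall>p. \<alpha> p \<noteq> p)) \<and>
     (\<forall>K. compact K \<longrightarrow> finite {\<alpha>\<in>\<Gamma>. \<alpha> ` K \<inter> K \<noteq> {}}) \<and>
     compact_space (orbit_topology \<Gamma>)"

text \<open>
  The exponential map of \<open>H\<^sup>3\<close> at \<open>p\<close> is a diffeomorphism taking the \<open>r\<close>-ball of the tangent space
  onto \<open>ball p r\<close>, and that of the quotient at \<open>orbit \<Gamma> p\<close> is its composition with the local isometry
  \<open>orbit \<Gamma>\<close>.  So it is injective on the \<open>r\<close>-ball iff \<open>orbit \<Gamma>\<close> is injective on \<open>ball p r\<close>.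
\<close>

definition injectivity_radius_at :: "(h3 \<Rightarrow> h3) set \<Rightarrow> h3 \<Rightarrow> real" where
  "injectivity_radius_at \<Gamma> p = Sup {r. 0 < r \<and> inj_on (orbit \<Gamma>) (ball p r)}"

definition injectivity_radius :: "(h3 \<Rightarrow> h3) set \<Rightarrow> real" where
  "injectivity_radius \<Gamma> = (INF p. injectivity_radius_at \<Gamma> p)"

text \<open>The geodesics of the quotient are the projections of the geodesics of \<open>H\<^sup>3\<close>.\<close>

definition unit_geodesic_segment :: "(h3 \<Rightarrow> h3) set \<Rightarrow> (real \<Rightarrow> h3 set) \<Rightarrow> bool" where
  "unit_geodesic_segment \<Gamma> \<gamma> \<longleftrightarrow>
     (\<exists>c. geodesic_line c \<and> (\<forall>t\<in>{0..1}. \<gamma> t = orbit \<Gamma> (c t)))"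

definition geodesic_lift :: "(h3 \<Rightarrow> h3) set \<Rightarrow> (real \<Rightarrow> h3 set) \<Rightarrow> (real \<Rightarrow> h3) \<Rightarrow> bool" where
  "geodesic_lift \<Gamma> \<gamma> c \<longleftrightarrow> geodesic_line c \<and> (\<forall>t\<in>{0..1}. orbit \<Gamma> (c t) = \<gamma> t)"

text \<open>
  No convention is imposed on the boundary: the open Dirichlet domain, the closed one, and an exact
  fundamental domain between the two all qualify.
\<close>

definition dirichlet_domain :: "(h3 \<Rightarrow> h3) set \<Rightarrow> h3 \<Rightarrow> h3 set \<Rightarrow> bool" where
  "dirichlet_domain \<Gamma> p D \<longleftrightarrow>
     {x. \<forall>\<alpha>\<in>\<Gamma>. \<alpha> \<noteq> id \<longrightarrow> dist x p < dist x (\<alpha> p)} \<subseteq> D \<and>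
     D \<subseteq> {x. \<forall>\<alpha>\<in>\<Gamma>. dist x p \<le> dist x (\<alpha> p)}"

definition tube :: "real \<Rightarrow> (real \<Rightarrow> h3) \<Rightarrow> h3 set" where
  "tube R c = {p. infdist p (range c) \<le> R}"

definition tube_translates ::
    "(h3 \<Rightarrow> h3) set \<Rightarrow> h3 set \<Rightarrow> real \<Rightarrow> (real \<Rightarrow> h3) \<Rightarrow> (h3 \<Rightarrow> h3) set" where
  "tube_translates \<Gamma> D R c = {\<alpha>\<in>\<Gamma>. \<alpha> ` D \<inter> tube R c \<noteq> {}}"

definition phase :: "(real \<Rightarrow> h3) \<Rightarrow> (h3 \<Rightarrow> h3) \<Rightarrow> real \<Rightarrow> real \<Rightarrow> real" where
  "phase c \<alpha> t s = dist (c t) (\<alpha> (c s))"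


section \<open>Mixed partial derivatives\<close>

definition partial_t :: "(real \<Rightarrow> real \<Rightarrow> real) \<Rightarrow> real \<Rightarrow> real \<Rightarrow> real" where
  "partial_t f t s = deriv (\<lambda>t'. f t' s) t"

definition partial_s :: "(real \<Rightarrow> real \<Rightarrow> real) \<Rightarrow> real \<Rightarrow> real \<Rightarrow> real" where
  "partial_s f t s = deriv (\<lambda>s'. f t s') s"

definition mixed_partial :: "nat \<times> nat \<Rightarrow> (real \<Rightarrow> real \<Rightarrow> real) \<Rightarrow> real \<Rightarrow> real \<Rightarrow> real" where
  "mixed_partial \<mu> f = (partial_t ^^ fst \<mu>) ((partial_s ^^ snd \<mu>) f)"

text \<open>
  \<^const>\<open>deriv\<close> is total, so the existence of all the derivatives entering \<^const>\<open>mixed_partial\<close>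
  on a set is a separate condition.
\<close>

definition mixed_partial_exists_on ::
    "(real \<times> real) set \<Rightarrow> nat \<times> nat \<Rightarrow> (real \<Rightarrow> real \<Rightarrow> real) \<Rightarrow> bool" where
  "mixed_partial_exists_on U \<mu> f \<longleftrightarrow>
     (\<forall>j<snd \<mu>. \<forall>(t, s)\<in>U.
        (\<lambda>s'. (partial_s ^^ j) f t s') differentiable (at s)) \<and>
     (\<forall>i<fst \<mu>. \<forall>(t, s)\<in>U.
        (\<lambda>t'. (partial_t ^^ i) ((partial_s ^^ snd \<mu>) f) t' s) differentiable (at t))"

definition unit_square :: "(real \<times> real) set" where
  "unit_square = {0..1} \<times> {0..1}"

definition sup_norm_on :: "(real \<times> real) set \<Rightarrow> (real \<Rightarrow> real \<Rightarrow> real) \<Rightarrow> ereal" where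
  "sup_norm_on S f = (SUP (t, s)\<in>S. ereal \<bar>f t s\<bar>)"

end

theory Submission imports Defs begin

text \<open>
  Put \<open>F(t, s) = cosh \<phi>(t, s) = - mink (c t) (\<alpha> (c s))\<close>.  In the hyperboloid model a unit-speed
  geodesic is a combination of two fixed vectors with coefficients \<open>sinh (1 - t) / sinh 1\<close> and
  \<open>sinh t / sinh 1\<close> (lemma \<open>geodesic_line_eq\<close>), and \<open>\<alpha>\<close> carries geodesics to geodesics.
  Hence \<open>F\<close> is determined by its four values at the corners of the unit square and solves
  \<open>F\<^sub>t\<^sub>t = F = F\<^sub>s\<^sub>s\<close>.  This has two consequences.  The only functions that repeated differentiation
  of \<open>F\<close> produces are \<open>F\<close>, \<open>F\<^sub>t\<close>, \<open>F\<^sub>s\<close> and \<open>F\<^sub>t\<^sub>s\<close>; and as the corner values are at most \<open>cosh T\<close>,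
  all four are at most \<open>16 exp T\<close> in absolute value on the square (lemma \<open>corner_jet_bound\<close>).

  Since \<open>\<phi>\<^sub>t = F\<^sub>t / sinh \<phi>\<close> and the derivative of \<open>w = 1 / sinh \<phi>\<close> is \<open>- F F\<^sub>t w\<^sup>3\<close>, and likewise in \<open>s\<close>, the
  polynomials in \<open>\<phi>\<close>, \<open>w\<close>, \<open>F\<close>, \<open>F\<^sub>t\<close>, \<open>F\<^sub>s\<close>, \<open>F\<^sub>t\<^sub>s\<close> are closed under both partial derivatives.  So each
  \<open>D\<^sup>\<mu> \<phi>\<close> is the value of such a polynomial, which depends on \<open>\<mu>\<close> only.  The assumption \<open>\<phi> \<ge> 2\<close> keeps
  \<open>w\<close> below \<open>1\<close>, so every variable is bounded by \<open>16 exp T \<le> exp (2 T)\<close> for large \<open>T\<close>, and the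
  polynomial by a power of \<open>exp (2 T)\<close> whose exponent again depends on \<open>\<mu>\<close> only.
\<close>

section \<open>Derivatives of the inverse hyperbolic cosine along a jet\<close>

text \<open>
  The polynomials are kept as syntax, apart from the functions substituted into them, because the
  bound on a derivative must be uniform in these functions: one formal derivative and one exponent
  serve all pairs of geodesics.  \<open>Dist\<close> stands for \<open>\<phi>\<close>, \<open>Csch\<close> for \<open>1 / sinh \<phi>\<close>.  In \<open>Jet p q\<close>, one of
  \<open>F\<close>, \<open>F\<^sub>t\<close>, \<open>F\<^sub>s\<close>, \<open>F\<^sub>t\<^sub>s\<close>, the flags are the parities of the orders of differentiation in \<open>t\<close> and in \<open>s\<close>;
  parities are enough because \<open>F\<^sub>t\<^sub>t = F = F\<^sub>s\<^sub>s\<close>.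
\<close>

datatype jet_poly =
    Dist
  | Csch
  | Jet bool bool
  | Neg jet_poly
  | Add jet_poly jet_poly
  | Mul jet_poly jet_poly

primrec jet_val :: "(bool \<Rightarrow> bool \<Rightarrow> real) \<Rightarrow> jet_poly \<Rightarrow> real" where
  "jet_val h Dist = arcosh (h False False)"
| "jet_val h Csch = 1 / sinh (arcosh (h False False))"
| "jet_val h (Jet p q) = h p q"
| "jet_val h (Neg e) = - jet_val h e"
| "jet_val h (Add e e') = jet_val h e + jet_val h e'"
| "jet_val h (Mul e e') = jet_val h e * jet_val h e'"

text \<open>
  The flags \<open>u\<close> and \<open>v\<close> select the variable: differentiation toggles the parity of the order in \<open>t\<close>
  if \<open>u\<close> holds and of the order in \<open>s\<close> if \<open>v\<close> holds, so \<open>jet_deriv True False\<close> is \<open>\<partial>\<^sub>t\<close> and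
  \<open>jet_deriv False True\<close> is \<open>\<partial>\<^sub>s\<close>.
\<close>

primrec jet_deriv :: "bool \<Rightarrow> bool \<Rightarrow> jet_poly \<Rightarrow> jet_poly" where
  "jet_deriv u v Dist = Mul (Jet u v) Csch"
| "jet_deriv u v Csch = Neg (Mul (Jet False False) (Mul (Jet u v) (Mul Csch (Mul Csch Csch))))"
| "jet_deriv u v (Jet p q) = Jet (p \<noteq> u) (q \<noteq> v)"
| "jet_deriv u v (Neg e) = Neg (jet_deriv u v e)"
| "jet_deriv u v (Add e e') = Add (jet_deriv u v e) (jet_deriv u v e')"
| "jet_deriv u v (Mul e e') = Add (Mul (jet_deriv u v e) e') (Mul e (jet_deriv u v e'))"

lemma arcosh_compose_has_derivative:
  assumes f: "(f has_real_derivative f') (at x)" and gt: "f x > 1"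
  shows "((\<lambda>x. arcosh (f x)) has_real_derivative f' * (1 / sinh (arcosh (f x)))) (at x)"
proof -
  have "sinh (arcosh (f x)) = sqrt ((f x)\<^sup>2 - 1)"
    using gt by (simp add: sinh_arcosh_real)
  then show ?thesis
    using DERIV_chain2[OF arcosh_real_has_field_derivative[OF gt] f] by (simp add: mult.commute)
qed

text \<open>
  The partial derivatives in \<open>t\<close> and in \<open>s\<close> are both derivatives along a line, so a single statement
  about one real variable covers them; the condition \<open>F > 1\<close> keeps away from the singularity of
  \<open>arcosh\<close> at \<open>1\<close>.
\<close>

lemma jet_val_has_derivative:
  fixes g :: "real \<Rightarrow> bool \<Rightarrow> bool \<Rightarrow> real"
  assumes g: "\<And>p q. ((\<lambda>x. g x p q) has_real_derivative g x (p \<noteq> u) (q \<noteq> v)) (at x)"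
    and gt: "g x False False > 1"
  shows "((\<lambda>x. jet_val (g x) e) has_real_derivative jet_val (g x) (jet_deriv u v e)) (at x)"
proof (induction e)
  case Dist
  show ?case
    using arcosh_compose_has_derivative[OF g[of False False] gt] by simp
next
  case Csch
  define w where "w = sinh (arcosh (g x False False))"
  have w: "w > 0"
    using gt arcosh_real_strict_mono[of 1 "g x False False"] by (simp add: w_def)
  have c: "cosh (arcosh (g x False False)) = g x False False"
    using gt by simp
  have d: "((\<lambda>x. arcosh (g x False False)) has_real_derivative g x u v * (1 / w)) (at x)"
    using arcosh_compose_has_derivative[OF g[of False False] gt] by (simp add: w_def)
  show ?case
    using w unfolding jet_val.simps jet_deriv.simps w_def[symmetric]
    by (auto intro!: derivative_eq_intros d simp: c w_def[symmetric] field_simps)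
next
  case (Jet p q)
  show ?case using g by simp
qed (auto intro!: derivative_eq_intros)

text \<open>
  A monomial of degree \<open>N\<close> in quantities bounded by \<open>B\<close> is at most \<open>B ^ N\<close>.  Requiring \<open>B \<ge> 2\<close> makes a
  further factor \<open>B\<close> pay for each addition, so that no multiplicative constant is needed.
\<close>

lemma jet_val_bound:
  "\<exists>N. \<forall>h B. 2 \<le> B \<and> \<bar>jet_val h Dist\<bar> \<le> B \<and> \<bar>jet_val h Csch\<bar> \<le> B \<and> (\<forall>p q. \<bar>h p q\<bar> \<le> B)
     \<longrightarrow> \<bar>jet_val h e\<bar> \<le> B ^ N"
proof (induction e)
  case Dist then show ?case by (intro exI[of _ 1]) auto
next
  case Csch then show ?case by (intro exI[of _ 1]) auto
next
  case (Jet p q) then show ?case by (intro exI[of _ 1]) auto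
next
  case (Neg e) then show ?case by auto
next
  case (Add e e')
  then obtain N N' where
    N: "\<And>h B. 2 \<le> B \<and> \<bar>jet_val h Dist\<bar> \<le> B \<and> \<bar>jet_val h Csch\<bar> \<le> B \<and> (\<forall>p q. \<bar>h p q\<bar> \<le> B)
      \<Longrightarrow> \<bar>jet_val h e\<bar> \<le> B ^ N" and
    N': "\<And>h B. 2 \<le> B \<and> \<bar>jet_val h Dist\<bar> \<le> B \<and> \<bar>jet_val h Csch\<bar> \<le> B \<and> (\<forall>p q. \<bar>h p q\<bar> \<le> B)
      \<Longrightarrow> \<bar>jet_val h e'\<bar> \<le> B ^ N'"
    by metis
  show ?case
  proof (intro exI[of _ "Suc (N + N')"] allI impI)
    fix h :: "bool \<Rightarrow> bool \<Rightarrow> real" and B :: real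
    assume B: "2 \<le> B \<and> \<bar>jet_val h Dist\<bar> \<le> B \<and> \<bar>jet_val h Csch\<bar> \<le> B \<and> (\<forall>p q. \<bar>h p q\<bar> \<le> B)"
    have "\<bar>jet_val h e\<bar> \<le> B ^ (N + N')"
      using N[OF B] B by (meson le_add1 one_le_numeral order_trans power_increasing)
    moreover have "\<bar>jet_val h e'\<bar> \<le> B ^ (N + N')"
      using N'[OF B] B by (meson le_add2 one_le_numeral order_trans power_increasing)
    moreover have "2 * B ^ (N + N') \<le> B * B ^ (N + N')"
      using B by (intro mult_right_mono) auto
    ultimately show "\<bar>jet_val h (Add e e')\<bar> \<le> B ^ Suc (N + N')"
      by simp
  qed
next
  case (Mul e e')
  then obtain N N' where
    N: "\<And>h B. 2 \<le> B \<and> \<bar>jet_val h Dist\<bar> \<le> B \<and> \<bar>jet_val h Csch\<bar> \<le> B \<and> (\<forall>p q. \<bar>h p q\<bar> \<le> B)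
      \<Longrightarrow> \<bar>jet_val h e\<bar> \<le> B ^ N" and
    N': "\<And>h B. 2 \<le> B \<and> \<bar>jet_val h Dist\<bar> \<le> B \<and> \<bar>jet_val h Csch\<bar> \<le> B \<and> (\<forall>p q. \<bar>h p q\<bar> \<le> B)
      \<Longrightarrow> \<bar>jet_val h e'\<bar> \<le> B ^ N'"
    by metis
  show ?case
  proof (intro exI[of _ "N + N'"] allI impI)
    fix h :: "bool \<Rightarrow> bool \<Rightarrow> real" and B :: real
    assume B: "2 \<le> B \<and> \<bar>jet_val h Dist\<bar> \<le> B \<and> \<bar>jet_val h Csch\<bar> \<le> B \<and> (\<forall>p q. \<bar>h p q\<bar> \<le> B)"
    show "\<bar>jet_val h (Mul e e')\<bar> \<le> B ^ (N + N')"
      using mult_mono[OF N[OF B] N'[OF B]] B by (simp add: abs_mult power_add)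
  qed
qed

text \<open>
  The flags of \<open>h t s p q\<close> are those of \<open>Jet p q\<close>.  Since differentiating twice in the same variable
  restores the flags, the condition contains the differential equations \<open>F\<^sub>t\<^sub>t = F\<close> and \<open>F\<^sub>s\<^sub>s = F\<close>.
\<close>

definition hyperbolic_jet :: "(real \<Rightarrow> real \<Rightarrow> bool \<Rightarrow> bool \<Rightarrow> real) \<Rightarrow> bool" where
  "hyperbolic_jet h \<longleftrightarrow> (\<forall>t s p q.
     ((\<lambda>t. h t s p q) has_real_derivative h t s (\<not> p) q) (at t) \<and>
     ((\<lambda>s. h t s p q) has_real_derivative h t s p (\<not> q)) (at s))"

text \<open>
  The function \<open>f\<close> is represented by \<open>e\<close> on an open set only, which suffices for its derivatives there
  and lets the statement be iterated.
\<close>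

lemma partial_t_jet_val:
  assumes h: "hyperbolic_jet h" and U: "open U" and gt: "\<And>t s. (t, s) \<in> U \<Longrightarrow> h t s False False > 1"
    and f: "\<And>t s. (t, s) \<in> U \<Longrightarrow> f t s = jet_val (h t s) e" and ts: "(t, s) \<in> U"
  shows "(\<lambda>t. f t s) differentiable (at t)"
    and "partial_t f t s = jet_val (h t s) (jet_deriv True False e)"
proof -
  have "((\<lambda>t. jet_val (h t s) e) has_real_derivative jet_val (h t s) (jet_deriv True False e)) (at t)"
    using h gt[OF ts] by (intro jet_val_has_derivative) (auto simp: hyperbolic_jet_def)
  moreover have "open {t. (t, s) \<in> U}"
    using open_vimage[OF U, of "\<lambda>t. (t, s)"] by (simp add: vimage_def continuous_on_Pair)
  ultimately have d: "((\<lambda>t. f t s) has_real_derivative jet_val (h t s) (jet_deriv True False e)) (at t)"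
    by (rule has_field_derivative_transform_within_open) (use ts f in auto)
  then show "(\<lambda>t. f t s) differentiable (at t)" by (auto simp: real_differentiable_def)
  show "partial_t f t s = jet_val (h t s) (jet_deriv True False e)"
    unfolding partial_t_def by (rule DERIV_imp_deriv[OF d])
qed

lemma partial_s_jet_val:
  assumes h: "hyperbolic_jet h" and U: "open U" and gt: "\<And>t s. (t, s) \<in> U \<Longrightarrow> h t s False False > 1"
    and f: "\<And>t s. (t, s) \<in> U \<Longrightarrow> f t s = jet_val (h t s) e" and ts: "(t, s) \<in> U"
  shows "(\<lambda>s. f t s) differentiable (at s)"
    and "partial_s f t s = jet_val (h t s) (jet_deriv False True e)"
proof -
  have "((\<lambda>s. jet_val (h t s) e) has_real_derivative jet_val (h t s) (jet_deriv False True e)) (at s)"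
    using h gt[OF ts] by (intro jet_val_has_derivative) (auto simp: hyperbolic_jet_def)
  moreover have "open {s. (t, s) \<in> U}"
    using open_vimage[OF U, of "\<lambda>s. (t, s)"] by (simp add: vimage_def continuous_on_Pair)
  ultimately have d: "((\<lambda>s. f t s) has_real_derivative jet_val (h t s) (jet_deriv False True e)) (at s)"
    by (rule has_field_derivative_transform_within_open) (use ts f in auto)
  then show "(\<lambda>s. f t s) differentiable (at s)" by (auto simp: real_differentiable_def)
  show "partial_s f t s = jet_val (h t s) (jet_deriv False True e)"
    unfolding partial_s_def by (rule DERIV_imp_deriv[OF d])
qed

definition mixed_deriv :: "nat \<times> nat \<Rightarrow> jet_poly" where
  "mixed_deriv \<mu> = (jet_deriv True False ^^ fst \<mu>) ((jet_deriv False True ^^ snd \<mu>) Dist)"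

lemma mixed_partial_jet_val:
  assumes h: "hyperbolic_jet h" and U: "open U" and gt: "\<And>t s. (t, s) \<in> U \<Longrightarrow> h t s False False > 1"
    and f: "\<And>t s. (t, s) \<in> U \<Longrightarrow> f t s = arcosh (h t s False False)"
  shows "mixed_partial_exists_on U \<mu> f"
    and "(t, s) \<in> U \<Longrightarrow> mixed_partial \<mu> f t s = jet_val (h t s) (mixed_deriv \<mu>)"
proof -
  have js: "(partial_s ^^ j) f t s = jet_val (h t s) ((jet_deriv False True ^^ j) Dist)"
    if "(t, s) \<in> U" for j t s
    using that
  proof (induction j arbitrary: t s)
    case 0
    then show ?case using f by simp
  next
    case (Suc j)
    show ?case
      using partial_s_jet_val(2)[OF h U gt Suc.IH Suc.prems] by simp
  qed
  define e where "e = (jet_deriv False True ^^ snd \<mu>) Dist"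
  have jt: "(partial_t ^^ i) ((partial_s ^^ snd \<mu>) f) t s = jet_val (h t s) ((jet_deriv True False ^^ i) e)"
    if "(t, s) \<in> U" for i t s
    using that
  proof (induction i arbitrary: t s)
    case 0
    then show ?case using js by (simp add: e_def)
  next
    case (Suc i)
    show ?case
      using partial_t_jet_val(2)[OF h U gt Suc.IH Suc.prems] by simp
  qed
  show "mixed_partial_exists_on U \<mu> f"
    using partial_s_jet_val(1)[OF h U gt js] partial_t_jet_val(1)[OF h U gt jt]
    by (auto simp: mixed_partial_exists_on_def)
  show "mixed_partial \<mu> f t s = jet_val (h t s) (mixed_deriv \<mu>)" if "(t, s) \<in> U"
    using jt[OF that] by (simp add: mixed_partial_def mixed_deriv_def e_def)
qed

section \<open>Geodesics in the hyperboloid model\<close>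

text \<open>
  For \<open>d = False\<close> this is the solution of \<open>u'' = u\<close> with \<open>u 0 = a\<close> and \<open>u 1 = b\<close>; for \<open>d = True\<close> it is the
  derivative \<open>u'\<close> of that solution.
\<close>

definition hyp_interp :: "bool \<Rightarrow> real \<Rightarrow> real \<Rightarrow> real \<Rightarrow> real" where
  "hyp_interp d a b t =
     (if d then b * cosh t - a * cosh (1 - t) else a * sinh (1 - t) + b * sinh t) / sinh 1"

lemma hyp_interp_has_derivative:
  assumes "(f has_real_derivative f') (at x)" "(g has_real_derivative g') (at x)"
  shows "((\<lambda>x. hyp_interp d (f x) (g x) t) has_real_derivative hyp_interp d f' g' t) (at x)"
  using assms by (cases d) (auto simp: hyp_interp_def intro!: derivative_eq_intros)

lemma hyp_interp_has_derivative_param: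
  "((\<lambda>t. hyp_interp d a b t) has_real_derivative hyp_interp (\<not> d) a b t) (at t)"
  by (cases d) (auto simp: hyp_interp_def intro!: derivative_eq_intros)

lemma continuous_on_hyp_interp [continuous_intros]:
  assumes "continuous_on S f" "continuous_on S g" "continuous_on S k"
  shows "continuous_on S (\<lambda>x. hyp_interp d (f x) (g x) (k x))"
  using assms by (cases d) (auto simp: hyp_interp_def intro!: continuous_intros)

lemma cosh_1_le: "cosh 1 \<le> 2 * sinh (1::real)"
proof -
  have "2 \<le> exp (1::real)" using exp_ge_add_one_self[of 1] by simp
  then have "3 * exp (- 1) \<le> exp (1::real)"
    using mult_mono[of 2 "exp (1::real)" 2 "exp 1"]
    by (simp add: exp_minus field_simps)
  then show ?thesis
    by (simp add: cosh_field_def sinh_field_def)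
qed

text \<open>
  Each of the two terms is at most \<open>2 M\<close>, because \<open>sinh\<close> and \<open>cosh\<close> are at most \<open>2 sinh 1\<close> on the unit
  interval; for \<open>cosh\<close> this is the preceding estimate at \<open>1\<close>.
\<close>

lemma hyp_interp_bound:
  assumes t: "t \<in> {0..1}" and ab: "\<bar>a\<bar> \<le> M" "\<bar>b\<bar> \<le> M"
  shows "\<bar>hyp_interp d a b t\<bar> \<le> 4 * M"
proof -
  have s1: "sinh (1::real) > 0" by simp
  have weight: "\<bar>sinh x\<bar> \<le> 2 * sinh 1" "\<bar>cosh x\<bar> \<le> 2 * sinh 1" if "x \<in> {0..1}" for x :: real
  proof -
    have "sinh x \<le> sinh 1" "sinh x \<ge> 0" using that by simp_all
    then show "\<bar>sinh x\<bar> \<le> 2 * sinh 1" using s1 by linarith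
    have "cosh x \<le> cosh 1" using that by (simp add: cosh_real_nonneg_le_iff)
    then show "\<bar>cosh x\<bar> \<le> 2 * sinh 1" using cosh_1_le cosh_real_nonneg[of x] by linarith
  qed
  have prod: "\<bar>k * y\<bar> \<le> M * (2 * sinh 1)" if "\<bar>k\<bar> \<le> M" "\<bar>y\<bar> \<le> 2 * sinh 1" for k y :: real
    using that by (simp only: abs_mult) (intro mult_mono, auto)
  have t': "1 - t \<in> {0..1}" using t by simp
  have "\<bar>if d then b * cosh t - a * cosh (1 - t) else a * sinh (1 - t) + b * sinh t\<bar>
      \<le> 4 * (M * sinh 1)"
    using prod[OF ab(1) weight(1)[OF t']] prod[OF ab(2) weight(1)[OF t]]
      prod[OF ab(1) weight(2)[OF t']] prod[OF ab(2) weight(2)[OF t]]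
    by (cases d) auto
  then show ?thesis
    using s1 by (simp add: hyp_interp_def divide_simps)
qed

lemma geodesic_line_mink:
  assumes "geodesic_line c"
  shows "mink (Rep_h3 (c s)) (Rep_h3 (c t)) = - cosh (s - t)"
proof -
  have "hdist (c s) (c t) = \<bar>s - t\<bar>"
    using assms by (simp add: geodesic_line_def dist_h3_def)
  then show ?thesis
    using cosh_hdist[of "c s" "c t"] by (simp add: cosh_real_abs)
qed

text \<open>
  On the orthogonal complement of a point of the hyperboloid the Minkowski form is positive definite.
\<close>

lemma mink_orth_null_eq_0:
  assumes "mink (Rep_h3 p) v = 0" "mink v v = 0"
  shows "v = 0"
proof -
  have f0: "fst v = 0" using mink_orth_bound[OF assms(1)] assms(2) by simp
  moreover have "snd v = 0" using f0 assms(2) by (simp add: mink_def)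
  ultimately show ?thesis by (simp add: prod_eq_iff)
qed

text \<open>
  The difference \<open>v\<close> of the two sides is Minkowski-orthogonal to \<open>c 0\<close>, \<open>c 1\<close> and \<open>c t\<close>: the products of
  points of a geodesic are prescribed by the distances, and the rest is the addition theorem.  Being
  itself a combination of these three vectors, \<open>v\<close> is then also null, so it vanishes.
\<close>

lemma geodesic_line_eq:
  assumes c: "geodesic_line c"
  shows "Rep_h3 (c t) = (sinh (1 - t) / sinh 1) *\<^sub>R Rep_h3 (c 0) + (sinh t / sinh 1) *\<^sub>R Rep_h3 (c 1)"
proof -
  define x y where "x = sinh (1 - t) / sinh 1" and "y = sinh t / sinh 1"
  define v where "v = Rep_h3 (c t) + ((- x) *\<^sub>R Rep_h3 (c 0) + (- y) *\<^sub>R Rep_h3 (c 1))"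
  note bil = mink_add_left mink_add_right mink_scale_left mink_scale_right
  note m = geodesic_line_mink[OF c]
  have s1: "sinh (1::real) \<noteq> 0" by simp
  have "cosh t = x + y * cosh 1"
    using s1 sinh_diff[of 1 t] by (simp add: x_def y_def field_simps)
  then have o0: "mink (Rep_h3 (c 0)) v = 0"
    unfolding v_def bil m by (simp add: cosh_minus)
  have "cosh (1 - t) = x * cosh 1 + y"
    using s1 sinh_diff[of 1 "1 - t"] by (simp add: x_def y_def field_simps)
  then have o1: "mink (Rep_h3 (c 1)) v = 0"
    unfolding v_def bil m by simp
  have "x * cosh t + y * cosh (1 - t) = sinh ((1 - t) + t) / sinh 1"
    unfolding sinh_add by (simp add: x_def y_def add_divide_distrib mult.commute)
  then have "x * cosh t + y * cosh (1 - t) = 1"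
    using s1 by simp
  moreover have sym: "cosh (t - 1) = cosh (1 - t)"
    using cosh_minus[of "1 - t"] by simp
  ultimately have ot: "mink (Rep_h3 (c t)) v = 0"
    unfolding v_def bil m sym by simp
  have "mink v v = mink v (Rep_h3 (c t)) + (- x * mink v (Rep_h3 (c 0)) + - y * mink v (Rep_h3 (c 1)))"
    by (subst (2) v_def) (simp only: bil)
  then have "mink v v = 0" using o0 o1 ot by (simp add: mink_sym[of v "Rep_h3 _"])
  then have "v = 0" using mink_orth_null_eq_0[OF o0] by simp
  moreover have "Rep_h3 (c t) = v + (x *\<^sub>R Rep_h3 (c 0) + y *\<^sub>R Rep_h3 (c 1))"
    by (simp add: v_def)
  ultimately show ?thesis
    by (simp add: x_def y_def)
qed

text \<open>
  The jet of the function with values \<open>a i j\<close> at the corners \<open>(i, j)\<close> of the unit square that solves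
  \<open>u'' = u\<close> in each variable: interpolation in \<open>s\<close> along the two edges \<open>t = 0\<close> and \<open>t = 1\<close>, and then
  in \<open>t\<close> between them.
\<close>

definition corner_jet :: "(nat \<Rightarrow> nat \<Rightarrow> real) \<Rightarrow> real \<Rightarrow> real \<Rightarrow> bool \<Rightarrow> bool \<Rightarrow> real" where
  "corner_jet a t s p q = hyp_interp p (hyp_interp q (a 0 0) (a 0 1) s) (hyp_interp q (a 1 0) (a 1 1) s) t"

lemma hyperbolic_jet_corner_jet: "hyperbolic_jet (corner_jet a)"
  unfolding hyperbolic_jet_def corner_jet_def
  by (intro allI conjI hyp_interp_has_derivative hyp_interp_has_derivative_param)

lemma corner_jet_bound:
  assumes "\<And>i j. i \<le> 1 \<Longrightarrow> j \<le> 1 \<Longrightarrow> \<bar>a i j\<bar> \<le> M" "t \<in> {0..1}" "s \<in> {0..1}"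
  shows "\<bar>corner_jet a t s p q\<bar> \<le> 16 * M"
proof -
  have "\<bar>corner_jet a t s p q\<bar> \<le> 4 * (4 * M)"
    unfolding corner_jet_def using assms by (intro hyp_interp_bound) auto
  then show ?thesis by simp
qed

lemma cosh_dist_geodesic_lines:
  assumes c: "geodesic_line c" "geodesic_line c'"
  shows "cosh (dist (c t) (c' s)) =
    corner_jet (\<lambda>i j. cosh (dist (c (real i)) (c' (real j)))) t s False False"
  unfolding dist_h3_def cosh_hdist corner_jet_def
  by (subst geodesic_line_eq[OF c(1), of t], subst geodesic_line_eq[OF c(2), of s])
    (simp add: mink_add_left mink_add_right mink_scale_left mink_scale_right hyp_interp_def field_simps)

section \<open>The exponential bound\<close>

lemma geodesic_line_isometry:
  assumes "hyperbolic_isometry \<alpha>" "geodesic_line c"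
  shows "geodesic_line (\<lambda>s. \<alpha> (c s))"
  using assms by (simp add: hyperbolic_isometry_def geodesic_line_def)

lemma csch_le_1:
  fixes x :: real
  assumes "2 \<le> x"
  shows "\<bar>1 / sinh x\<bar> \<le> 1"
proof -
  have "2 * sinh 1 \<ge> cosh (1::real)" "cosh (1::real) \<ge> 1"
    by (rule cosh_1_le, rule cosh_real_ge_1)
  then have "2 * sinh 1 * cosh (1::real) \<ge> 1"
    using mult_mono[of 1 "2 * sinh 1" 1 "cosh (1::real)"] by simp
  then have "1 \<le> sinh (2::real)" using sinh_double[of "1::real"] by simp
  also have "\<dots> \<le> sinh x" using assms by simp
  finally have "1 \<le> sinh x" .
  then show ?thesis by (simp only: abs_divide divide_le_eq) auto
qed

text \<open>
  The estimate concerns two arbitrary geodesic lines, and its constant depends on \<open>\<mu>\<close> alone.  The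
  derivatives are represented on the open set where \<open>cosh \<phi> > 1\<close>, that is, where the two points
  are distinct.
\<close>

lemma geodesic_distance_mixed_partials:
  "\<exists>C. \<forall>T\<ge>15. \<forall>c c'. geodesic_line c \<and> geodesic_line c' \<and>
     (\<forall>t\<in>{0..1}. \<forall>s\<in>{0..1}. 2 \<le> dist (c t) (c' s) \<and> dist (c t) (c' s) \<le> T) \<longrightarrow>
     (\<exists>U. open U \<and> unit_square \<subseteq> U \<and> mixed_partial_exists_on U \<mu> (\<lambda>t s. dist (c t) (c' s))) \<and>
     (\<forall>t\<in>{0..1}. \<forall>s\<in>{0..1}.
        \<bar>mixed_partial \<mu> (\<lambda>t s. dist (c t) (c' s)) t s\<bar> \<le> exp (C * T))"
proof -
  obtain N where N: "\<And>h B. 2 \<le> B \<Longrightarrow> \<bar>jet_val h Dist\<bar> \<le> B \<Longrightarrow> \<bar>jet_val h Csch\<bar> \<le> B \<Longrightarrow>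
      (\<And>p q. \<bar>h p q\<bar> \<le> B) \<Longrightarrow> \<bar>jet_val h (mixed_deriv \<mu>)\<bar> \<le> B ^ N"
    using jet_val_bound[of "mixed_deriv \<mu>"] by metis
  show ?thesis
  proof (intro exI[of _ "2 * real N"] allI impI)
    fix T :: real and c c'
    assume T: "15 \<le> T"
      and a: "geodesic_line c \<and> geodesic_line c' \<and>
        (\<forall>t\<in>{0..1}. \<forall>s\<in>{0..1}. 2 \<le> dist (c t) (c' s) \<and> dist (c t) (c' s) \<le> T)"
    define \<phi> where "\<phi> = (\<lambda>t s. dist (c t) (c' s))"
    define h where "h = corner_jet (\<lambda>i j. cosh (\<phi> (real i) (real j)))"
    define U where "U = {(t, s). h t s False False > 1}"
    have c: "geodesic_line c" "geodesic_line c'" using a by auto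
    have rng: "2 \<le> \<phi> t s" "\<phi> t s \<le> T" if "t \<in> {0..1}" "s \<in> {0..1}" for t s
      using a that by (auto simp: \<phi>_def)
    have cosh\<phi>: "cosh (\<phi> t s) = h t s False False" for t s
      unfolding \<phi>_def h_def by (rule cosh_dist_geodesic_lines[OF c])
    have \<phi>: "\<phi> t s = arcosh (h t s False False)" for t s
      unfolding cosh\<phi>[symmetric] by (simp add: arcosh_cosh_real \<phi>_def)
    have jet: "hyperbolic_jet h"
      unfolding h_def by (rule hyperbolic_jet_corner_jet)
    have U: "open U"
    proof -
      have "continuous_on UNIV (\<lambda>x. h (fst x) (snd x) False False)"
        unfolding h_def corner_jet_def by (intro continuous_intros)
      then have "open {x. 1 < h (fst x) (snd x) False False}"
        by (intro open_Collect_less continuous_intros)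
      then show ?thesis by (simp add: U_def case_prod_unfold)
    qed
    have gt: "h t s False False > 1" if "(t, s) \<in> U" for t s
      using that by (simp add: U_def)
    have sq: "(t, s) \<in> U" if "t \<in> {0..1}" "s \<in> {0..1}" for t s
    proof -
      have "cosh 0 < cosh (\<phi> t s)"
        using rng(1)[OF that] by (subst cosh_real_nonneg_less_iff) auto
      then show ?thesis by (simp add: U_def cosh\<phi>)
    qed
    note mp = mixed_partial_jet_val[where h = h and U = U and f = \<phi>, OF jet U gt \<phi>]
    have exT: "T + 1 \<le> exp T" using exp_ge_add_one_self[of T] by linarith
    \<comment> \<open>The threshold \<open>15\<close> on \<open>T\<close> serves to absorb the factor \<open>16\<close> of the corner estimate.\<close>
    have "16 * exp T \<le> exp T * exp T"
      using exT T by (intro mult_right_mono) auto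
    also have "\<dots> = exp (2 * T)" by (simp flip: exp_add)
    finally have B: "16 * exp T \<le> exp (2 * T)" .
    have bound: "\<bar>mixed_partial \<mu> \<phi> t s\<bar> \<le> exp (2 * real N * T)"
      if ts: "t \<in> {0..1}" "s \<in> {0..1}" for t s
    proof -
      have "\<bar>jet_val (h t s) (mixed_deriv \<mu>)\<bar> \<le> exp (2 * T) ^ N"
      proof (rule N)
        show B2: "2 \<le> exp (2 * T)" using B exT T by linarith
        show "\<bar>jet_val (h t s) Dist\<bar> \<le> exp (2 * T)"
          using rng[OF ts] B exT T by (simp flip: \<phi>)
        show "\<bar>jet_val (h t s) Csch\<bar> \<le> exp (2 * T)"
          using csch_le_1[OF rng(1)[OF ts]] B2 unfolding jet_val.simps \<phi>[symmetric] by linarith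
        fix p q
        have "\<bar>cosh (\<phi> (real i) (real j))\<bar> \<le> exp T" if "i \<le> 1" "j \<le> 1" for i j
        proof -
          have r: "2 \<le> \<phi> (real i) (real j)" "\<phi> (real i) (real j) \<le> T"
            using that by (auto intro!: rng)
          have "cosh (\<phi> (real i) (real j)) \<le> cosh T"
            using r by (subst cosh_real_nonneg_le_iff) auto
          also have "\<dots> \<le> exp T"
            using T by (simp add: cosh_field_def)
          finally show ?thesis by simp
        qed
        then have "\<bar>h t s p q\<bar> \<le> 16 * exp T"
          unfolding h_def using ts by (intro corner_jet_bound)
        then show "\<bar>h t s p q\<bar> \<le> exp (2 * T)" using B by linarith
      qed
      also have "\<dots> = exp (2 * real N * T)"
        by (simp add: exp_of_nat_mult[symmetric] mult_ac)
      finally show ?thesis using mp(2)[OF _ sq[OF ts]] by simp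
    qed
    show "(\<exists>U. open U \<and> unit_square \<subseteq> U \<and> mixed_partial_exists_on U \<mu> (\<lambda>t s. dist (c t) (c' s))) \<and>
        (\<forall>t\<in>{0..1}. \<forall>s\<in>{0..1}.
          \<bar>mixed_partial \<mu> (\<lambda>t s. dist (c t) (c' s)) t s\<bar> \<le> exp (2 * real N * T))"
      using U sq mp(1)[of \<mu>] bound unfolding \<phi>_def[symmetric] unit_square_def
      by (intro conjI exI[of _ U]) auto
  qed
qed

theorem lemma4:
  "\<exists>r\<^sub>0>0. \<forall>(\<Gamma> :: (h3 \<Rightarrow> h3) set) (\<gamma> :: real \<Rightarrow> h3 set) (c :: real \<Rightarrow> h3) (D :: h3 set) (A :: real) (R :: real).
     compact_hyperbolic_manifold \<Gamma> \<and> r\<^sub>0 \<le> injectivity_radius \<Gamma> \<and>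
     unit_geodesic_segment \<Gamma> \<gamma> \<and> geodesic_lift \<Gamma> \<gamma> c \<and>
     dirichlet_domain \<Gamma> (c 0) D \<and>
     1 \<le> A \<and> injectivity_radius \<Gamma> / A \<le> R \<and> R \<le> A * injectivity_radius \<Gamma> \<longrightarrow>
     (\<forall>\<mu> :: nat \<times> nat. \<exists>C :: real. \<forall>\<^sub>F T :: real in at_top. \<forall>\<alpha>\<in>\<Gamma>.
        \<alpha> \<notin> tube_translates \<Gamma> D R c \<and>
        \<not> (\<exists>P. hyperbolic_plane P \<and> range c \<subseteq> P \<and> \<alpha> ` range c \<subseteq> P) \<and>
        (\<forall>t\<in>{0..1}. \<forall>s\<in>{0..1}. 2 \<le> phase c \<alpha> t s \<and> phase c \<alpha> t s \<le> T) \<longrightarrow>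
        (\<exists>U. open U \<and> unit_square \<subseteq> U \<and> mixed_partial_exists_on U \<mu> (phase c \<alpha>)) \<and>
        sup_norm_on unit_square (mixed_partial \<mu> (phase c \<alpha>)) \<le> ereal (exp (C * T)))"
proof (rule exI[of _ 1], intro conjI allI impI, goal_cases)
  case 1
  then show ?case by simp
next
  case (2 \<Gamma> \<gamma> c D A R \<mu>)
  obtain C where C: "\<forall>T\<ge>15. \<forall>c c'. geodesic_line c \<and> geodesic_line c' \<and>
     (\<forall>t\<in>{0..1}. \<forall>s\<in>{0..1}. 2 \<le> dist (c t) (c' s) \<and> dist (c t) (c' s) \<le> T) \<longrightarrow>
     (\<exists>U. open U \<and> unit_square \<subseteq> U \<and> mixed_partial_exists_on U \<mu> (\<lambda>t s. dist (c t) (c' s))) \<and>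
     (\<forall>t\<in>{0..1}. \<forall>s\<in>{0..1}.
        \<bar>mixed_partial \<mu> (\<lambda>t s. dist (c t) (c' s)) t s\<bar> \<le> exp (C * T))"
    using geodesic_distance_mixed_partials[of \<mu>] by (elim exE)
  have c: "geodesic_line c" using 2 by (simp add: geodesic_lift_def)
  have iso: "hyperbolic_isometry \<alpha>" if "\<alpha> \<in> \<Gamma>" for \<alpha>
    using 2 that by (simp add: compact_hyperbolic_manifold_def isometry_group_def)
  have phase: "phase c \<alpha> = (\<lambda>t s. dist (c t) (\<alpha> (c s)))" for \<alpha>
    by (intro ext) (simp add: phase_def)
  show ?case
  proof (rule exI[of _ C], intro eventually_mono[OF eventually_ge_at_top[of 15]] ballI impI)
    fix T \<alpha>
    assume T: "15 \<le> T" and \<alpha>: "\<alpha> \<in> \<Gamma>"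
      and a: "\<alpha> \<notin> tube_translates \<Gamma> D R c \<and>
        \<not> (\<exists>P. hyperbolic_plane P \<and> range c \<subseteq> P \<and> \<alpha> ` range c \<subseteq> P) \<and>
        (\<forall>t\<in>{0..1}. \<forall>s\<in>{0..1}. 2 \<le> phase c \<alpha> t s \<and> phase c \<alpha> t s \<le> T)"
    have lines: "geodesic_line c \<and> geodesic_line (\<lambda>s. \<alpha> (c s)) \<and>
        (\<forall>t\<in>{0..1}. \<forall>s\<in>{0..1}. 2 \<le> dist (c t) (\<alpha> (c s)) \<and> dist (c t) (\<alpha> (c s)) \<le> T)"
      using a c geodesic_line_isometry[OF iso[OF \<alpha>] c] unfolding phase by (intro conjI) simp_all
    note bound = C[rule_format, OF T lines, folded phase]
    have "sup_norm_on unit_square (mixed_partial \<mu> (phase c \<alpha>)) \<le> ereal (exp (C * T))"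
      unfolding sup_norm_on_def unit_square_def
    proof (rule SUP_least, clarify)
      fix t s :: real
      assume "t \<in> {0..1}" "s \<in> {0..1}"
      then show "ereal \<bar>mixed_partial \<mu> (phase c \<alpha>) t s\<bar> \<le> ereal (exp (C * T))"
        using conjunct2[OF bound] by simp
    qed
    with conjunct1[OF bound]
    show "(\<exists>U. open U \<and> unit_square \<subseteq> U \<and> mixed_partial_exists_on U \<mu> (phase c \<alpha>)) \<and>
        sup_norm_on unit_square (mixed_partial \<mu> (phase c \<alpha>)) \<le> ereal (exp (C * T))"
      by (rule conjI)
  qed
qed

end
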